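(* If a topological space $X$ satisfies the selection principle $\mathsf{S}_1(\mathcal{G}_K,\mathcal{G}_{D_\Gamma})$, then $X$ is productively weakly Scheepers, i.e. $X\times Y$ is weakly Scheepers for every weakly Scheepers space $Y$.
   Context: For a space $X$: $\mathcal{G}_K$ is the class of all families $\mathcal{U}$ of $G_\delta$ subsets of $X$ such that $X\notin\mathcal{U}$ and every compact set $C\subseteq X$ is contained in some $U\in\mathcal{U}$. $\mathcal{G}_{D_\Gamma}$ is the class of all infinite families $\mathcal{U}$ of $G_\delta$ subsets of $X$ such that for each nonempty open set $U\subseteq X$ the set $\{V\in\mathcal{U}:U\cap V=\emptyset\}$ is finite. $X$ satisfies $\mathsf{S}_1(\mathcal{A},\mathcal{B})$ if for each sequence $(\mathcal{U}_n)_{n\in\mathbb{N}}$ of elements of $\mathcal{A}$ there are $V_n\in\mathcal{U}_n$ ($n\in\mathbb{N}$) with $\{V_n:n\in\mathbb{N}\}\in\mathcal{B}$. A space $Z$ is weakly Scheepers if for every sequence $(\mathcal{U}_n)_{n\in\mathbb{N}}$ of open covers of $Z$ there are finite $\mathcal{V}_n\subseteq\mathcal{U}_n$ such that for every finite collection $\mathcal{F}$ of nonempty open subsets of $Z$ there is an $n$ (equivalently, there are infinitely many $n$) with $U\cap\left(\bigcup\mathcal{V}_n\right)\neq\emptyset$ for all $U\in\mathcal{F}$. *)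

theory Defs
  imports "HOL-Analysis.Analysis"
begin

text \<open>Families are unindexed, so a selection that repeats a set infinitely often may have a
  finite range; this matters because \<open>G_D_Gamma\<close> below requires infinite families.\<close>

definition S1 :: "'a set set set \<Rightarrow> 'a set set set \<Rightarrow> bool" where
  "S1 \<A> \<B> \<longleftrightarrow>
     (\<forall>\<U> :: nat \<Rightarrow> 'a set set. (\<forall>n. \<U> n \<in> \<A>) \<longrightarrow>
        (\<exists>V. (\<forall>n. V n \<in> \<U> n) \<and> range V \<in> \<B>))"

definition G_K :: "'a topology \<Rightarrow> 'a set set set" where
  "G_K X = {\<U>. (\<forall>U\<in>\<U>. gdelta_in X U) \<and> topspace X \<notin> \<U> \<and>
               (\<forall>C. compactin X C \<longrightarrow> (\<exists>U\<in>\<U>. C \<subseteq> U))}"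

definition G_D_Gamma :: "'a topology \<Rightarrow> 'a set set set" where
  "G_D_Gamma X = {\<U>. (\<forall>U\<in>\<U>. gdelta_in X U) \<and> infinite \<U> \<and>
               (\<forall>U. openin X U \<and> U \<noteq> {} \<longrightarrow> finite {V\<in>\<U>. U \<inter> V = {}})}"

definition open_cover :: "'a topology \<Rightarrow> 'a set set \<Rightarrow> bool" where
  "open_cover X \<U> \<longleftrightarrow> (\<forall>U\<in>\<U>. openin X U) \<and> \<Union>\<U> = topspace X"

definition weakly_Scheepers :: "'a topology \<Rightarrow> bool" where
  "weakly_Scheepers Z \<longleftrightarrow>
     (\<forall>\<U> :: nat \<Rightarrow> 'a set set. (\<forall>n. open_cover Z (\<U> n)) \<longrightarrow>
        (\<exists>\<V>. (\<forall>n. finite (\<V> n) \<and> \<V> n \<subseteq> \<U> n) \<and>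
             (\<forall>\<F>. finite \<F> \<and> (\<forall>U\<in>\<F>. openin Z U \<and> U \<noteq> {}) \<longrightarrow>
                  (\<exists>n. \<forall>U\<in>\<F>. U \<inter> \<Union>(\<V> n) \<noteq> {}))))"

end

theory Submission
  imports Defs
begin

text \<open>For a compact \<open>C\<close>, the sets \<open>V\<close> such that some \<open>U \<times> V\<close> with \<open>C \<subseteq> U\<close> is covered by finitely
  many members of \<open>\<U> n\<close> form an open cover of \<open>Y\<close> (tube lemma). Selecting finitely many such
  \<open>V\<close> for every \<open>n\<close> and intersecting all the corresponding \<open>U\<close> gives a \<open>G\<^sub>\<delta>\<close> set \<open>G C \<supseteq> C\<close>
  and finite \<open>H C n \<subseteq> \<U> n\<close>. The selection principle, applied to the constant sequence
  with value \<open>{G C | C compact}\<close>, yields countably many \<open>C m\<close> such that any finitely many nonempty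
  open sets all meet some \<open>G (C m)\<close>; if some \<open>G C\<close> is the whole space, this \<open>C\<close> alone does. The required selection is \<open>\<Union>m\<le>n. H (C m) n\<close>; since \<open>Y\<close>
  provides infinitely many good \<open>n\<close> for \<open>C m\<close>, one of them satisfies \<open>n \<ge> m\<close>.\<close>

text \<open>The property is applied to every tail of the sequence of covers, and the selections are
  merged diagonally. A good index for the tail starting at \<open>k\<close> is a good index at least
  \<open>k\<close> for the merged selection.\<close>

lemma weakly_Scheepers_frequently:
  fixes \<U> :: "nat \<Rightarrow> 'a set set"
  assumes "weakly_Scheepers Y" and "\<And>n. open_cover Y (\<U> n)"
  shows "\<exists>\<V>. (\<forall>n. finite (\<V> n) \<and> \<V> n \<subseteq> \<U> n) \<and>
           (\<forall>\<F> k. finite \<F> \<and> (\<forall>U\<in>\<F>. openin Y U \<and> U \<noteq> {}) \<longrightarrow>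
              (\<exists>n\<ge>k. \<forall>U\<in>\<F>. U \<inter> \<Union>(\<V> n) \<noteq> {}))"
proof -
  define sel where "sel k \<W> \<longleftrightarrow> (\<forall>n. finite (\<W> n) \<and> \<W> n \<subseteq> \<U> (n + k)) \<and>
      (\<forall>\<F>. finite \<F> \<and> (\<forall>U\<in>\<F>. openin Y U \<and> U \<noteq> {}) \<longrightarrow> (\<exists>n. \<forall>U\<in>\<F>. U \<inter> \<Union>(\<W> n) \<noteq> {}))" for k \<W>
  have "\<exists>\<W>. sel k \<W>" for k
    unfolding sel_def
    by (rule assms(1)[unfolded weakly_Scheepers_def, THEN spec, of "\<lambda>n. \<U> (n + k)", THEN mp])
       (simp add: assms(2))
  then obtain \<W> where \<W>: "\<And>k. sel k (\<W> k)"
    by metis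
  have fin: "finite (\<W> k n)" and sub: "\<W> k n \<subseteq> \<U> (n + k)" for k n
    using \<W>[of k] by (simp_all add: sel_def)
  have hit: "\<exists>n. \<forall>U\<in>\<F>. U \<inter> \<Union>(\<W> k n) \<noteq> {}"
    if "finite \<F>" "\<forall>U\<in>\<F>. openin Y U \<and> U \<noteq> {}" for k \<F>
    using \<W>[of k] that unfolding sel_def by simp
  \<comment> \<open>\<open>\<W> k\<close> selects from the sequence shifted by \<open>k\<close>, so
    \<open>\<W> k (n - k)\<close> is drawn from \<open>\<U> n\<close>. Only the tails with
    \<open>k \<le> n\<close> reach index \<open>n\<close>, which keeps the union finite.\<close>
  define \<V> where "\<V> n = (\<Union>k\<le>n. \<W> k (n - k))" for n
  show ?thesis
  proof (intro exI[of _ \<V>] conjI allI impI)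
    show "finite (\<V> n)" for n
      using fin by (simp add: \<V>_def)
    show "\<V> n \<subseteq> \<U> n" for n
      unfolding \<V>_def by (rule UN_least) (metis atMost_iff le_add_diff_inverse2 sub)
    fix \<F> k
    assume \<F>: "finite \<F> \<and> (\<forall>U\<in>\<F>. openin Y U \<and> U \<noteq> {})"
    obtain n where n: "\<forall>U\<in>\<F>. U \<inter> \<Union>(\<W> k n) \<noteq> {}"
      using hit[OF conjunct1[OF \<F>] conjunct2[OF \<F>]] ..
    have "\<W> k (n + k - k) \<subseteq> \<V> (n + k)"
      unfolding \<V>_def by (rule UN_upper) simp
    then have "\<Union>(\<W> k n) \<subseteq> \<Union>(\<V> (n + k))"
      by (simp add: Union_mono)
    with n have "\<forall>U\<in>\<F>. U \<inter> \<Union>(\<V> (n + k)) \<noteq> {}"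
      by blast
    then show "\<exists>n\<ge>k. \<forall>U\<in>\<F>. U \<inter> \<Union>(\<V> n) \<noteq> {}"
      using le_add2 by blast
  qed
qed

text \<open>Turns covers of the product into covers of \<open>Y\<close>, to which the hypothesis on
  \<open>Y\<close> applies. Finitely many members cover the compact slice
  \<open>C \<times> {y}\<close>, and Wallace's theorem fits an open box around the slice into their
  union.\<close>

lemma open_cover_tubes:
  assumes \<U>: "open_cover (prod_topology X Y) \<U>" and C: "compactin X C"
  shows "open_cover Y {V. openin Y V \<and>
           (\<exists>U \<F>. openin X U \<and> C \<subseteq> U \<and> finite \<F> \<and> \<F> \<subseteq> \<U> \<and> U \<times> V \<subseteq> \<Union>\<F>)}"
    (is "open_cover Y ?\<V>")
proof -
  have "\<exists>V\<in>?\<V>. y \<in> V" if y: "y \<in> topspace Y" for y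
  proof -
    have "compactin (prod_topology X Y) (C \<times> {y})"
      using C y by (simp add: compactin_Times)
    moreover have "C \<times> {y} \<subseteq> \<Union>\<U>"
      using \<U> y compactin_subset_topspace[OF C] by (auto simp: open_cover_def)
    ultimately obtain \<F> where \<F>: "finite \<F>" "\<F> \<subseteq> \<U>" "C \<times> {y} \<subseteq> \<Union>\<F>"
      using \<U> unfolding compactin_def open_cover_def by meson
    have "openin (prod_topology X Y) (\<Union>\<F>)"
      using \<U> \<F> by (auto simp: open_cover_def)
    then obtain U V where "openin X U" "openin Y V" "C \<subseteq> U" "{y} \<subseteq> V" "U \<times> V \<subseteq> \<Union>\<F>"
      using Wallace_theorem_prod_topology[OF C, of Y "{y}"] y \<F>(3) by auto
    with \<F> show ?thesis
      by blast
  qed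
  then show ?thesis
    by (auto simp: open_cover_def dest: openin_subset)
qed

lemma gdelta_in_INT_openin:
  fixes U :: "nat \<Rightarrow> 'a set"
  assumes "\<And>n. openin X (U n)"
  shows "gdelta_in X (\<Inter>n. U n)"
  by (rule gdelta_in_Inter) (use assms open_imp_gdelta_in in auto)

text \<open>A single \<open>G\<close> has to serve all \<open>n\<close> at once, so it is a
  countable intersection of open sets, hence only a \<open>G\<^sub>\<delta>\<close> set. The
  conclusion asks for one point \<open>y\<close> of each \<open>V\<close> because \<open>V\<close>
  is only known to meet a selected tube base, not to lie in it.\<close>

lemma weakly_Scheepers_gdelta_tube:
  fixes \<U> :: "nat \<Rightarrow> ('a \<times> 'b) set set"
  assumes Y: "weakly_Scheepers Y" and \<U>: "\<And>n. open_cover (prod_topology X Y) (\<U> n)"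
    and C: "compactin X C"
  shows "\<exists>G \<H>. gdelta_in X G \<and> C \<subseteq> G \<and> (\<forall>n. finite (\<H> n) \<and> \<H> n \<subseteq> \<U> n) \<and>
           (\<forall>\<F> k. finite \<F> \<and> (\<forall>V\<in>\<F>. openin Y V \<and> V \<noteq> {}) \<longrightarrow>
              (\<exists>n\<ge>k. \<forall>V\<in>\<F>. \<exists>y\<in>V. G \<times> {y} \<subseteq> \<Union>(\<H> n)))"
proof -
  define \<T> where "\<T> n = {V. openin Y V \<and>
      (\<exists>U \<F>. openin X U \<and> C \<subseteq> U \<and> finite \<F> \<and> \<F> \<subseteq> \<U> n \<and> U \<times> V \<subseteq> \<Union>\<F>)}" for n
  have "open_cover Y (\<T> n)" for n
    unfolding \<T>_def by (rule open_cover_tubes[OF \<U> C])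
  from weakly_Scheepers_frequently[where ?\<U> = \<T>, OF Y this] obtain \<V>
    where \<V>: "\<forall>n. finite (\<V> n) \<and> \<V> n \<subseteq> \<T> n"
    and hit: "\<forall>\<F> k. finite \<F> \<and> (\<forall>U\<in>\<F>. openin Y U \<and> U \<noteq> {}) \<longrightarrow>
           (\<exists>n\<ge>k. \<forall>U\<in>\<F>. U \<inter> \<Union>(\<V> n) \<noteq> {})"
    by (elim exE conjE) (rule that)
  have fin: "finite (\<V> n)" and tube: "\<V> n \<subseteq> \<T> n" for n
    using \<V> by auto
  have "\<forall>n. \<forall>V\<in>\<V> n. \<exists>U \<F>. openin X U \<and> C \<subseteq> U \<and> finite \<F> \<and> \<F> \<subseteq> \<U> n \<and> U \<times> V \<subseteq> \<Union>\<F>"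
    using tube unfolding \<T>_def by blast
  then obtain U \<E> where U: "\<And>n V. V \<in> \<V> n \<Longrightarrow> openin X (U n V) \<and> C \<subseteq> U n V"
    and \<E>: "\<And>n V. V \<in> \<V> n \<Longrightarrow> finite (\<E> n V) \<and> \<E> n V \<subseteq> \<U> n \<and> U n V \<times> V \<subseteq> \<Union>(\<E> n V)"
    by metis
  \<comment> \<open>The factor \<open>topspace X\<close> matters when \<open>\<V> n\<close> is
    empty, where the bare intersection would be the whole type.\<close>
  define W where "W n = topspace X \<inter> (\<Inter>V\<in>\<V> n. U n V)" for n
  define \<H> where "\<H> n = (\<Union>V\<in>\<V> n. \<E> n V)" for n
  show ?thesis
  proof (intro exI[of _ "\<Inter>n. W n"] exI[of _ \<H>] conjI allI impI)
    have "openin X (W n)" for n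
    proof (cases "\<V> n = {}")
      case False
      then have "openin X (\<Inter>V\<in>\<V> n. U n V)"
        using U fin by (intro openin_Inter) auto
      then show ?thesis
        by (simp add: W_def openin_Int)
    qed (simp add: W_def)
    then show "gdelta_in X (\<Inter>n. W n)"
      by (rule gdelta_in_INT_openin)
    show "C \<subseteq> (\<Inter>n. W n)"
      using U compactin_subset_topspace[OF C] by (auto simp: W_def)
    show "finite (\<H> n)" for n
      using \<E> fin by (auto simp: \<H>_def)
    show "\<H> n \<subseteq> \<U> n" for n
      using \<E> by (fastforce simp: \<H>_def)
    fix \<F> k
    assume "finite \<F> \<and> (\<forall>V\<in>\<F>. openin Y V \<and> V \<noteq> {})"
    then obtain n where n: "n \<ge> k" "\<forall>V\<in>\<F>. V \<inter> \<Union>(\<V> n) \<noteq> {}"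
      using hit by meson
    have "\<exists>y\<in>V. (\<Inter>n. W n) \<times> {y} \<subseteq> \<Union>(\<H> n)" if V: "V \<in> \<F>" for V
    proof -
      from n V obtain y V' where y: "y \<in> V" "y \<in> V'" "V' \<in> \<V> n"
        by blast
      then have "(\<Inter>n. W n) \<times> {y} \<subseteq> U n V' \<times> V'"
        by (auto simp: W_def)
      also have "\<dots> \<subseteq> \<Union>(\<E> n V')"
        using \<E> y by blast
      also have "\<dots> \<subseteq> \<Union>(\<H> n)"
        using y by (auto simp: \<H>_def)
      finally show ?thesis
        using y by blast
    qed
    with n(1) show "\<exists>n\<ge>k. \<forall>V\<in>\<F>. \<exists>y\<in>V. (\<Inter>n. W n) \<times> {y} \<subseteq> \<Union>(\<H> n)"
      by (intro exI[of _ n]) simp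
  qed
qed

text \<open>The case split is forced by \<open>G_K\<close>, whose families must not contain the
  whole space. When some \<open>G C\<close> is the whole space, every nonempty open set meets it, so
  a constant sequence suffices.\<close>

lemma S1_G_K_G_D_Gamma_sequence:
  assumes S1: "S1 (G_K X) (G_D_Gamma X)"
    and G: "\<And>C. compactin X C \<Longrightarrow> gdelta_in X (G C) \<and> C \<subseteq> G C"
  obtains C :: "nat \<Rightarrow> 'a set" where "\<And>m. compactin X (C m)"
    "\<And>\<F>. \<lbrakk>finite \<F>; \<forall>U\<in>\<F>. openin X U \<and> U \<noteq> {}\<rbrakk> \<Longrightarrow> \<exists>m. \<forall>U\<in>\<F>. U \<inter> G (C m) \<noteq> {}"
proof (cases "\<exists>C. compactin X C \<and> G C = topspace X")
  case True
  then obtain C where C: "compactin X C" "G C = topspace X"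
    by blast
  have "U \<inter> G C \<noteq> {}" if "openin X U" "U \<noteq> {}" for U
    using that openin_subset[of X U] C by blast
  with C show thesis
    by (intro that[of "\<lambda>_. C"]) auto
next
  case False
  have "G ` {C. compactin X C} \<in> G_K X"
    using G False unfolding G_K_def by auto
  then obtain V :: "nat \<Rightarrow> 'a set" where V: "\<And>n. V n \<in> G ` {C. compactin X C}" "range V \<in> G_D_Gamma X"
    using S1[unfolded S1_def, rule_format, of "\<lambda>_. G ` {C. compactin X C}"] by blast
  then obtain C where C: "\<And>n. compactin X (C n)" "\<And>n. V n = G (C n)"
    unfolding image_iff by (metis mem_Collect_eq)
  have "\<exists>m. \<forall>U\<in>\<F>. U \<inter> G (C m) \<noteq> {}"
    if \<F>: "finite \<F>" "\<forall>U\<in>\<F>. openin X U \<and> U \<noteq> {}" for \<F>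
  proof -
    \<comment> \<open>Each \<open>U\<close> in \<open>\<F>\<close> misses only finitely many
      selected sets. As \<open>range V\<close> is infinite, some selected set is missed by no
      \<open>U\<close>.\<close>
    have "finite (\<Union>U\<in>\<F>. {W\<in>range V. U \<inter> W = {}})"
      using \<F> V(2) by (auto simp: G_D_Gamma_def)
    moreover have "infinite (range V)"
      using V(2) by (simp add: G_D_Gamma_def)
    ultimately obtain W where "W \<in> range V" "W \<notin> (\<Union>U\<in>\<F>. {W\<in>range V. U \<inter> W = {}})"
      by (meson finite_subset subsetI)
    then obtain m where m: "W = V m" "\<forall>U\<in>\<F>. U \<inter> W \<noteq> {}"
      by auto
    then show ?thesis
      by (intro exI[of _ m]) (simp add: C(2))
  qed
  with C(1) show thesis
    by (rule that)
qed

theorem theorem4p5: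
  fixes X :: "'a topology"
  assumes "S1 (G_K X) (G_D_Gamma X)"
  shows "\<forall>Y :: 'b topology. weakly_Scheepers Y \<longrightarrow> weakly_Scheepers (prod_topology X Y)"
proof (intro allI impI)
  fix Y :: "'b topology"
  assume Y: "weakly_Scheepers Y"
  show "weakly_Scheepers (prod_topology X Y)"
    unfolding weakly_Scheepers_def
  proof (intro allI impI)
    fix \<U> :: "nat \<Rightarrow> ('a \<times> 'b) set set"
    assume \<U>: "\<forall>n. open_cover (prod_topology X Y) (\<U> n)"
    define tube where "tube C G \<H> \<longleftrightarrow> gdelta_in X G \<and> C \<subseteq> G \<and>
        (\<forall>n. finite (\<H> n) \<and> \<H> n \<subseteq> \<U> n) \<and>
        (\<forall>\<F> k. finite \<F> \<and> (\<forall>V\<in>\<F>. openin Y V \<and> V \<noteq> {}) \<longrightarrow>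
           (\<exists>n\<ge>k. \<forall>V\<in>\<F>. \<exists>y\<in>V. G \<times> {y} \<subseteq> \<Union>(\<H> n)))" for C G \<H>
    have "\<exists>G \<H>. tube C G \<H>" if "compactin X C" for C
      unfolding tube_def by (rule weakly_Scheepers_gdelta_tube[OF Y spec[OF \<U>] that])
    then obtain G \<H> where tube: "\<And>C. compactin X C \<Longrightarrow> tube C (G C) (\<H> C)"
      by metis
    have G: "gdelta_in X (G C) \<and> C \<subseteq> G C"
      and \<H>: "finite (\<H> C n) \<and> \<H> C n \<subseteq> \<U> n" if "compactin X C" for C n
      using tube[OF that] by (simp_all add: tube_def)
    have hit: "\<exists>n\<ge>k. \<forall>V\<in>\<F>. \<exists>y\<in>V. G C \<times> {y} \<subseteq> \<Union>(\<H> C n)"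
      if "compactin X C" "finite \<F>" "\<forall>V\<in>\<F>. openin Y V \<and> V \<noteq> {}" for C \<F> k
      using tube[OF that(1)] that(2,3) unfolding tube_def by simp
    obtain C :: "nat \<Rightarrow> 'a set" where C: "\<And>m. compactin X (C m)"
      and meet: "\<And>\<F>. \<lbrakk>finite \<F>; \<forall>U\<in>\<F>. openin X U \<and> U \<noteq> {}\<rbrakk> \<Longrightarrow>
             \<exists>m. \<forall>U\<in>\<F>. U \<inter> G (C m) \<noteq> {}"
      using S1_G_K_G_D_Gamma_sequence[OF assms G] by metis
    define \<V> where "\<V> n = (\<Union>m\<le>n. \<H> (C m) n)" for n
    have "\<exists>n. \<forall>W\<in>\<F>. W \<inter> \<Union>(\<V> n) \<noteq> {}"
      if \<F>: "finite \<F>" "\<forall>W\<in>\<F>. openin (prod_topology X Y) W \<and> W \<noteq> {}" for \<F>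
    proof -
      \<comment> \<open>Shrinking to boxes separates the two factors: the sides \<open>A W\<close>
        determine \<open>m\<close>, and only then do the sides \<open>B W\<close> determine
        \<open>n\<close>, which depends on \<open>C m\<close>.\<close>
      have "\<forall>W\<in>\<F>. \<exists>A B. openin X A \<and> A \<noteq> {} \<and> openin Y B \<and> B \<noteq> {} \<and> A \<times> B \<subseteq> W"
      proof
        fix W assume W: "W \<in> \<F>"
        with \<F> obtain x y where "(x, y) \<in> W"
          by (metis ex_in_conv surj_pair)
        with \<F> W show "\<exists>A B. openin X A \<and> A \<noteq> {} \<and> openin Y B \<and> B \<noteq> {} \<and> A \<times> B \<subseteq> W"
          unfolding openin_prod_topology_alt by (metis empty_iff)
      qed
      then obtain A B where AB: "\<And>W. W \<in> \<F> \<Longrightarrow> openin X (A W) \<and> A W \<noteq> {}"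
        "\<And>W. W \<in> \<F> \<Longrightarrow> openin Y (B W) \<and> B W \<noteq> {}" "\<And>W. W \<in> \<F> \<Longrightarrow> A W \<times> B W \<subseteq> W"
        by metis
      obtain m where m: "\<forall>W\<in>\<F>. A W \<inter> G (C m) \<noteq> {}"
        using meet[of "A ` \<F>"] \<F>(1) AB(1) by auto
      have "finite (B ` \<F>)" "\<forall>V\<in>B ` \<F>. openin Y V \<and> V \<noteq> {}"
        using \<F>(1) AB(2) by auto
      from hit[OF C this] obtain n
        where n: "n \<ge> m" "\<forall>V\<in>B ` \<F>. \<exists>y\<in>V. G (C m) \<times> {y} \<subseteq> \<Union>(\<H> (C m) n)"
        by meson
      have "W \<inter> \<Union>(\<V> n) \<noteq> {}" if W: "W \<in> \<F>" for W
      proof -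
        \<comment> \<open>The points \<open>x\<close> and \<open>y\<close> can be chosen
          independently, since the whole slice of \<open>G (C m)\<close> at height \<open>y\<close>
          is covered.\<close>
        obtain x y where "x \<in> A W" "x \<in> G (C m)" "y \<in> B W" "G (C m) \<times> {y} \<subseteq> \<Union>(\<H> (C m) n)"
          using bspec[OF m W] bspec[OF n(2) imageI[OF W]] by (elim bexE) blast
        then have "(x, y) \<in> W" "(x, y) \<in> \<Union>(\<H> (C m) n)"
          using AB(3)[OF W] by auto
        moreover have "\<H> (C m) n \<subseteq> \<V> n"
          using n(1) by (auto simp: \<V>_def)
        ultimately show ?thesis
          by blast
      qed
      then show ?thesis
        by blast
    qed
    moreover have "finite (\<V> n) \<and> \<V> n \<subseteq> \<U> n" for n
      using \<H>[OF C] by (auto simp: \<V>_def)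
    ultimately show "\<exists>\<V>. (\<forall>n. finite (\<V> n) \<and> \<V> n \<subseteq> \<U> n) \<and>
        (\<forall>\<F>. finite \<F> \<and> (\<forall>U\<in>\<F>. openin (prod_topology X Y) U \<and> U \<noteq> {}) \<longrightarrow>
             (\<exists>n. \<forall>U\<in>\<F>. U \<inter> \<Union>(\<V> n) \<noteq> {}))"
      by (intro exI[of _ \<V>]) simp
  qed
qed

end
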